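(* Let $K$ be a compact convex shape in the plane. Then there exist four points on the boundary $\partial K$ of $K$ such that every path (rectifiable curve) in the plane passing through these four points has length at least $\frac12 \operatorname{per} K$.
   Context: A convex shape is a compact convex subset of the Euclidean plane $\mathbb{R}^2$ with non-empty interior. $\operatorname{per} K$ denotes the perimeter of $K$, i.e. the length of its boundary curve $\partial K$. All curves (paths) are continuous curves in the plane, assumed rectifiable (of finite length). A path connecting, or passing through, given points is one whose image contains all of these points, in any order; it is not required to stay inside $K$. *)

theory Defs
  imports "HOL-Analysis.Analysis"
begin

definition convex_shape :: "(real ^ 2) set \<Rightarrow> bool" where
  "convex_shape K \<longleftrightarrow> compact K \<and> convex K \<and> interior K \<noteq> {}"

(* Length as the supremum of the lengths of inscribed polygonal lines
   g (t 0), g (t 1), ..., g (t n) with 0 \<le> t 0 \<le> ... \<le> t n \<le> 1;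
   it is infinite exactly when g has unbounded variation. *)
definition curve_length :: "(real \<Rightarrow> 'a::metric_space) \<Rightarrow> ennreal" where
  "curve_length g =
     (SUP (n, t) \<in> {(n, t). mono_on {..n} t \<and> t ` {..n} \<subseteq> {0..1}}.
        \<Sum>i<n. ennreal (dist (g (t i)) (g (t (Suc i)))))"

definition rectifiable :: "(real \<Rightarrow> 'a::metric_space) \<Rightarrow> bool" where
  "rectifiable g \<longleftrightarrow> path g \<and> curve_length g < \<infinity>"

definition boundary_curve :: "(real ^ 2) set \<Rightarrow> (real \<Rightarrow> real ^ 2) \<Rightarrow> bool" where
  "boundary_curve K c \<longleftrightarrow>
     simple_path c \<and> pathfinish c = pathstart c \<and> path_image c = frontier K"

(* The choice of the parametrization is harmless: all simple closed
   parametrizations of the same curve have the same length, and for a convex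
   shape one exists (boundary_curve_exists). *)
definition perimeter :: "(real ^ 2) set \<Rightarrow> ennreal" where
  "perimeter K = curve_length (SOME c. boundary_curve K c)"

lemma boundary_curve_exists:
  assumes "convex_shape K"
  shows "\<exists>c. boundary_curve K c"
proof -
  have K: "compact K" "convex K" "interior K \<noteq> {}"
    using assms by (auto simp: convex_shape_def)
  have fr: "rel_frontier K = frontier K"
    using K by (intro rel_frontier_nonempty_interior)
  have ad: "aff_dim K = 2"
    using aff_dim_nonempty_interior[OF K(3)] by simp
  have ad': "aff_dim (cball (0::complex) 1) = 2"
    using aff_dim_cball[of 1 "0::complex"] by simp
  have fr': "rel_frontier (cball (0::complex) 1) = sphere 0 1"
    by (subst rel_frontier_nonempty_interior) (auto simp: frontier_cball)
  have "rel_frontier (cball (0::complex) 1) homeomorphic rel_frontier K"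
    using K ad ad'
    by (intro homeomorphic_rel_frontiers_convex_bounded_sets) (auto simp: compact_imp_bounded)
  then have "sphere (0::complex) 1 homeomorphic frontier K"
    by (simp only: fr fr')
  then obtain h k where hk: "homeomorphism (sphere (0::complex) 1) (frontier K) h k"
    by (auto simp: homeomorphic_def)
  define p where "p = (\<lambda>t::real. cis (2 * pi * t))"
  have "loop_free p"
    unfolding loop_free_def
  proof (intro ballI impI)
    fix x y :: real
    assume xy: "x \<in> {0..1}" "y \<in> {0..1}" and "p x = p y"
    then have "sin (2 * pi * x) = sin (2 * pi * y) \<and> cos (2 * pi * x) = cos (2 * pi * y)"
      by (simp add: p_def complex_eq_iff)
    then obtain n :: int where "2 * pi * x = 2 * pi * y + 2 * pi * n"
      using sin_cos_eq_iff by blast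
    then have "2 * pi * x = 2 * pi * (y + n)"
      by (simp add: algebra_simps)
    then have n: "x = y + n"
      by simp
    with xy have "-1 \<le> real_of_int n" "real_of_int n \<le> 1"
      by auto
    then have "n = -1 \<or> n = 0 \<or> n = 1"
      by linarith
    with n xy show "x = y \<or> x = 0 \<and> y = 1 \<or> x = 1 \<and> y = 0"
      by auto
  qed
  then have sp: "simple_path p"
    unfolding simple_path_def path_def p_def by (intro conjI continuous_intros)
  have "z \<in> p ` {0..1}" if z: "norm z = 1" for z
  proof -
    obtain t where t: "0 \<le> t" "t < 2 * pi" "z = Complex (cos t) (sin t)"
      using complex_unimodular_polar[OF z] by metis
    then have "z = p (t / (2 * pi))"
      by (simp add: p_def cis.code)
    with t show ?thesis
      by (intro image_eqI[of _ _ "t / (2 * pi)"]) (auto simp: divide_simps)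
  qed
  then have im: "path_image p = sphere 0 1"
    by (auto simp: path_image_def p_def)
  have "simple_path (h \<circ> p)"
    using hk sp im
    by (intro simple_path_continuous_image)
       (auto simp: homeomorphism_def intro: inj_on_inverseI[of _ k])
  moreover have "path_image (h \<circ> p) = frontier K"
    using hk im by (simp add: path_image_compose homeomorphism_def)
  ultimately show ?thesis
    unfolding boundary_curve_def
    by (intro exI[of _ "h \<circ> p"]) (simp add: pathfinish_def pathstart_def p_def)
qed

end

theory Submission
  imports Defs
begin

text \<open>
  The four points are the ends \<open>A\<close>, \<open>C\<close> of a diameter of \<open>K\<close>, of length \<open>2 * w\<close>, and
  the two points \<open>B\<close>, \<open>D\<close> in which the perpendicular bisector of \<open>A C\<close> meets the boundary,
  at distances \<open>b\<close> and \<open>d\<close> from the midpoint. They form a kite with sides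
  \<open>p = sqrt (w\<^sup>2 + b\<^sup>2)\<close> and \<open>q = sqrt (w\<^sup>2 + d\<^sup>2)\<close> and diagonals \<open>2 * w\<close> and \<open>b + d\<close>, all of
  them at most \<open>2 * w\<close>.

  The perimeter has two upper bounds. Since \<open>A C\<close> is a diameter, \<open>K\<close> lies in the strip between
  the perpendiculars to \<open>A C\<close> at \<open>A\<close> and \<open>C\<close>, hence in the trapezoid that the support
  lines at \<open>B\<close> and \<open>D\<close> cut out of this strip. As \<open>B\<close> and \<open>D\<close> are half-way, the parallel
  sides of the trapezoid have total length \<open>2 * (b + d)\<close>, and since \<open>A\<close> and \<open>C\<close> do not lie beyond the
  support line at \<open>B\<close>, its piece inside the strip is at most \<open>2 * p\<close> long (at most \<open>2 * q\<close> at \<open>D\<close>). So half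
  the perimeter is at most \<open>p + q + (b + d)\<close> (\<open>half_boundary_variation\<close>, applied to both sides
  of \<open>A C\<close>). Also all widths of \<open>K\<close> are at most \<open>2 * w\<close>, so an equiangular octagon around \<open>K\<close>
  bounds half the perimeter by \<open>8 * (sqrt 2 - 1) * w\<close> (\<open>boundary_variation_le_octagon\<close>).

  A curve through the four points is at least as long as some polygonal chain through them, so
  the sums of three chords remain to be compared with these bounds. Every chain other than those
  of three sides of the kite is at least \<open>p + q + (b + d)\<close>, because no side exceeds \<open>2 * w\<close>. Three
  sides have length \<open>2 * q + p\<close> or \<open>2 * p + q\<close>. If \<open>b + d \<le> q\<close>, then \<open>2 * q + p\<close> is large
  enough by the first bound. If \<open>q < b + d\<close>, the kite is so fat that \<open>2 * q + p\<close> exceeds the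
  octagon bound (\<open>two_short_sides_and_long_side\<close>). The other case is symmetric.

  Both perimeter estimates must hold for an arbitrary simple closed parametrization \<open>c\<close> of the boundary.
  What makes this possible is that a linear functional cannot rise, fall and rise again along \<open>c\<close> (\<open>boundary_curve_no_zigzag\<close>). It makes suitable functionals monotone on
  arcs of \<open>c\<close>, and the length is estimated by the total variations of a few functionals.
\<close>

section \<open>Length bounds from additive control functions\<close>

text \<open>
  An upper bound \<open>L\<close> for the variation of \<open>f\<close> on \<open>{p..q}\<close>, witnessed by a function \<open>G\<close> whose increments
  dominate all chords. With such witnesses, bounds on adjacent intervals and bounds for several
  functions can be added without refining partitions.
\<close>
definition variation_le :: "(real \<Rightarrow> 'a::metric_space) \<Rightarrow> real \<Rightarrow> real \<Rightarrow> real \<Rightarrow> bool" where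
  "variation_le f p q L \<longleftrightarrow>
     (\<exists>G. (\<forall>s t. p \<le> s \<and> s \<le> t \<and> t \<le> q \<longrightarrow> dist (f s) (f t) \<le> G t - G s) \<and> G q - G p \<le> L)"

lemma variation_leI:
  assumes "\<And>s t. p \<le> s \<Longrightarrow> s \<le> t \<Longrightarrow> t \<le> q \<Longrightarrow> dist (f s) (f t) \<le> G t - G s"
    and "G q - G p \<le> L"
  shows "variation_le f p q L"
  using assms unfolding variation_le_def by blast

lemma variation_leE:
  assumes "variation_le f p q L"
  obtains G where "\<And>s t. p \<le> s \<Longrightarrow> s \<le> t \<Longrightarrow> t \<le> q \<Longrightarrow> dist (f s) (f t) \<le> G t - G s"
    and "G q - G p \<le> L"
  using assms unfolding variation_le_def by blast

lemma variation_le_weaken: "variation_le f p q L \<Longrightarrow> L \<le> L' \<Longrightarrow> variation_le f p q L'"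
  unfolding variation_le_def by (meson order_trans)

lemma curve_length_le_variation:
  assumes "variation_le c 0 1 L"
  shows "curve_length c \<le> ennreal L"
proof -
  obtain G where G: "\<And>s t. 0 \<le> s \<Longrightarrow> s \<le> t \<Longrightarrow> t \<le> 1 \<Longrightarrow> dist (c s) (c t) \<le> G t - G s"
    and GL: "G 1 - G 0 \<le> L"
    using variation_leE[OF assms] by metis
  have Gm: "G s \<le> G t" if "0 \<le> s" "s \<le> t" "t \<le> 1" for s t
    using G[OF that] zero_le_dist[of "c s" "c t"] by linarith
  have "(\<Sum>i<n. ennreal (dist (c (t i)) (c (t (Suc i))))) \<le> ennreal L"
    if t: "mono_on {..n} t" "t ` {..n} \<subseteq> {0..1}" for n and t :: "nat \<Rightarrow> real"
  proof -
    have range: "0 \<le> t i \<and> t i \<le> 1" if "i \<le> n" for i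
      using t(2) that by auto
    have "(\<Sum>i<n. dist (c (t i)) (c (t (Suc i)))) \<le> (\<Sum>i<n. G (t (Suc i)) - G (t i))"
      using range t(1) by (intro sum_mono G) (auto simp: mono_on_def)
    also have "\<dots> = G (t n) - G (t 0)"
      by (rule sum_lessThan_telescope)
    also have "\<dots> \<le> G 1 - G 0"
      using Gm[of "t n" 1] Gm[of 0 "t 0"] range[of 0] range[of n] by simp
    also have "\<dots> \<le> L" by (rule GL)
    finally show ?thesis
      by (simp add: sum_ennreal ennreal_leI)
  qed
  then show ?thesis
    unfolding curve_length_def by (intro SUP_least) auto
qed

lemma variation_le_join:
  assumes "variation_le f p q L1" "variation_le f q r L2" "p \<le> q" "q \<le> r"
  shows "variation_le f p r (L1 + L2)"
proof -
  obtain G1 where G1: "\<And>s t. p \<le> s \<Longrightarrow> s \<le> t \<Longrightarrow> t \<le> q \<Longrightarrow> dist (f s) (f t) \<le> G1 t - G1 s"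
    and L1: "G1 q - G1 p \<le> L1" using variation_leE[OF assms(1)] by metis
  obtain G2 where G2: "\<And>s t. q \<le> s \<Longrightarrow> s \<le> t \<Longrightarrow> t \<le> r \<Longrightarrow> dist (f s) (f t) \<le> G2 t - G2 s"
    and L2: "G2 r - G2 q \<le> L2" using variation_leE[OF assms(2)] by metis
  define G where "G t = (if t \<le> q then G1 t else G1 q + (G2 t - G2 q))" for t
  show ?thesis
  proof (rule variation_leI[where G = G])
    fix s t assume st: "p \<le> s" "s \<le> t" "t \<le> r"
    consider "t \<le> q" | "q < s" | "s \<le> q" "q < t" by linarith
    then show "dist (f s) (f t) \<le> G t - G s"
    proof cases
      case 3
      have "dist (f s) (f t) \<le> dist (f s) (f q) + dist (f q) (f t)"
        by (rule dist_triangle)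
      also have "\<dots> \<le> (G1 q - G1 s) + (G2 t - G2 q)"
        using 3 st by (intro add_mono G1 G2) auto
      finally show ?thesis using 3 by (simp add: G_def)
    qed (use st G1 G2 in \<open>auto simp: G_def\<close>)
  next
    show "G r - G p \<le> L1 + L2"
      using L1 L2 assms(3,4) by (cases "r = q") (auto simp: G_def intro: order_trans)
  qed
qed

lemma variation_le_mono:
  fixes h :: "real \<Rightarrow> real"
  assumes "mono_on {p..q} h" "h q - h p \<le> L"
  shows "variation_le h p q L"
  using assms by (intro variation_leI[where G = h]) (auto simp: dist_real_def mono_on_def)

lemma variation_le_antimono:
  fixes h :: "real \<Rightarrow> real"
  assumes "mono_on {p..q} (\<lambda>t. - h t)" "h p - h q \<le> L"
  shows "variation_le h p q L"
  using assms by (intro variation_leI[where G = "\<lambda>t. - h t"]) (auto simp: dist_real_def mono_on_def)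

text \<open>
  For the coordinate functionals \<open>h i\<close> of a plane curve \<open>f\<close>, this reduces the length of \<open>f\<close>
  to the variations of real functions, which are known once these are monotone.
\<close>

lemma variation_le_sum:
  assumes "\<And>i. i \<in> I \<Longrightarrow> variation_le (h i) p q (L i)"
    and "\<And>i. i \<in> I \<Longrightarrow> 0 \<le> k i"
    and "\<And>s t. p \<le> s \<Longrightarrow> s \<le> t \<Longrightarrow> t \<le> q \<Longrightarrow>
           dist (f s) (f t) \<le> (\<Sum>i\<in>I. k i * dist (h i s) (h i t))"
  shows "variation_le f p q (\<Sum>i\<in>I. k i * L i)"
proof -
  have "\<forall>i\<in>I. \<exists>G. (\<forall>s t. p \<le> s \<and> s \<le> t \<and> t \<le> q \<longrightarrow> dist (h i s) (h i t) \<le> G t - G s) \<and> G q - G p \<le> L i"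
    using assms(1) by (simp add: variation_le_def)
  then obtain G where G: "\<And>i s t. i \<in> I \<Longrightarrow> p \<le> s \<Longrightarrow> s \<le> t \<Longrightarrow> t \<le> q \<Longrightarrow> dist (h i s) (h i t) \<le> G i t - G i s"
    and L: "\<And>i. i \<in> I \<Longrightarrow> G i q - G i p \<le> L i"
    unfolding bchoice_iff by blast
  show ?thesis
  proof (rule variation_leI[where G = "\<lambda>t. \<Sum>i\<in>I. k i * G i t"])
    fix s t assume st: "p \<le> s" "s \<le> t" "t \<le> q"
    have "dist (f s) (f t) \<le> (\<Sum>i\<in>I. k i * dist (h i s) (h i t))"
      using assms(3) st by blast
    also have "\<dots> \<le> (\<Sum>i\<in>I. k i * (G i t - G i s))"
      using G st assms(2) by (intro sum_mono mult_left_mono) auto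
    finally show "dist (f s) (f t) \<le> (\<Sum>i\<in>I. k i * G i t) - (\<Sum>i\<in>I. k i * G i s)"
      by (simp add: algebra_simps sum_subtractf)
  next
    have "(\<Sum>i\<in>I. k i * (G i q - G i p)) \<le> (\<Sum>i\<in>I. k i * L i)"
      using L assms(2) by (intro sum_mono mult_left_mono) auto
    then show "(\<Sum>i\<in>I. k i * G i q) - (\<Sum>i\<in>I. k i * G i p) \<le> (\<Sum>i\<in>I. k i * L i)"
      by (simp add: algebra_simps sum_subtractf)
  qed
qed

text \<open>
  The perimeter is defined through an arbitrary parametrization. This lemma allows the starting
  point of the closed curve to be moved to a prescribed boundary point.
\<close>

lemma variation_le_shiftpath:
  assumes c: "pathfinish c = pathstart c" and a: "0 \<le> a" "a \<le> 1"
    and var: "variation_le (shiftpath a c) 0 1 L"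
  shows "variation_le c 0 1 L"
proof -
  obtain G where G: "\<And>s t. 0 \<le> s \<Longrightarrow> s \<le> t \<Longrightarrow> t \<le> 1 \<Longrightarrow>
       dist (shiftpath a c s) (shiftpath a c t) \<le> G t - G s"
    and GL: "G 1 - G 0 \<le> L"
    using variation_leE[OF var] by metis
  have lo: "shiftpath a c (t + 1 - a) = c t" if "0 \<le> t" "t \<le> a" for t
    using c that by (cases "t = 0") (auto simp: shiftpath_def pathfinish_def pathstart_def)
  have hi: "shiftpath a c (t - a) = c t" if "a \<le> t" "t \<le> 1" for t
    using that by (auto simp: shiftpath_def)
  have "variation_le c 0 a (G 1 - G (1 - a))"
  proof (rule variation_leI[where G = "\<lambda>t. G (t + 1 - a)"])
    fix s t assume st: "0 \<le> s" "s \<le> t" "t \<le> a"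
    show "dist (c s) (c t) \<le> G (t + 1 - a) - G (s + 1 - a)"
      using G[of "s + 1 - a" "t + 1 - a"] st a lo[of s] lo[of t] by simp
  qed simp
  moreover have "variation_le c a 1 (G (1 - a) - G 0)"
  proof (rule variation_leI[where G = "\<lambda>t. G (t - a)"])
    fix s t assume st: "a \<le> s" "s \<le> t" "t \<le> 1"
    show "dist (c s) (c t) \<le> G (t - a) - G (s - a)"
      using G[of "s - a" "t - a"] st a hi[of s] hi[of t] by simp
  qed simp
  ultimately have "variation_le c 0 1 ((G 1 - G (1 - a)) + (G (1 - a) - G 0))"
    using a by (rule variation_le_join)
  then show ?thesis
    by (rule variation_le_weaken) (use GL in simp)
qed

section \<open>Plane geometry and supporting lines\<close>

lemma plane_orthogonal_parallel:
  fixes a u v :: "real ^ 2"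
  assumes "a \<bullet> u = 0" "a \<bullet> v = 0" "a \<noteq> 0" "u \<noteq> 0"
  obtains k where "v = k *\<^sub>R u"
proof -
  have 1: "a$1 * u$1 + a$2 * u$2 = 0" "a$1 * v$1 + a$2 * v$2 = 0"
    using assms by (auto simp: inner_vec_def sum_2)
  have a: "a$1 \<noteq> 0 \<or> a$2 \<noteq> 0" and u: "u$1 \<noteq> 0 \<or> u$2 \<noteq> 0"
    using assms by (auto simp: vec_eq_iff forall_2)
  have d: "u$1 * v$2 = u$2 * v$1" using 1 a by algebra
  have "v = (if u$1 \<noteq> 0 then v$1 / u$1 else v$2 / u$2) *\<^sub>R u"
    using d u by (auto simp: vec_eq_iff forall_2 field_simps)
  then show ?thesis using that by blast
qed

lemma plane_orthonormal_inner:
  fixes e n u v :: "real ^ 2"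
  assumes "norm e = 1" "norm n = 1" "e \<bullet> n = 0"
  shows "u \<bullet> v = (e \<bullet> u) * (e \<bullet> v) + (n \<bullet> u) * (n \<bullet> v)"
proof -
  have 1: "e$1 * e$1 + e$2 * e$2 = 1" "n$1 * n$1 + n$2 * n$2 = 1" "e$1 * n$1 + e$2 * n$2 = 0"
    using assms by (simp_all add: norm_eq_1 inner_vec_def sum_2)
  have "u$1 * v$1 + u$2 * v$2 =
      (e$1 * u$1 + e$2 * u$2) * (e$1 * v$1 + e$2 * v$2) +
      (n$1 * u$1 + n$2 * u$2) * (n$1 * v$1 + n$2 * v$2)"
    using 1 by algebra
  then show ?thesis
    by (simp add: inner_vec_def sum_2)
qed

lemma plane_orthonormal_norm:
  fixes e n v :: "real ^ 2"
  assumes "norm e = 1" "norm n = 1" "e \<bullet> n = 0"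
  shows "norm v = sqrt ((e \<bullet> v)\<^sup>2 + (n \<bullet> v)\<^sup>2)"
  using plane_orthonormal_inner[OF assms, of v v] by (simp add: norm_eq_sqrt_inner power2_eq_square)

lemma plane_orthonormal_expansion:
  fixes e n v :: "real ^ 2"
  assumes "norm e = 1" "norm n = 1" "e \<bullet> n = 0"
  shows "v = (e \<bullet> v) *\<^sub>R e + (n \<bullet> v) *\<^sub>R n"
proof -
  have "e \<bullet> e = 1" "n \<bullet> n = 1" "n \<bullet> e = 0"
    using assms by (auto simp: norm_eq_1 inner_commute)
  then have "norm (v - ((e \<bullet> v) *\<^sub>R e + (n \<bullet> v) *\<^sub>R n)) = 0"
    by (subst plane_orthonormal_norm[OF assms]) (simp add: algebra_simps assms)
  then show ?thesis by simp
qed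

lemma frontier_supporting_functional:
  fixes K :: "(real ^ 2) set"
  assumes K: "convex_shape K" and Q: "Q \<in> frontier K"
  obtains N where "N \<noteq> 0" "\<And>Z. Z \<in> K \<Longrightarrow> N \<bullet> Q \<le> N \<bullet> Z"
proof -
  have cK: "closure K = K" and conv: "convex K"
    using K by (auto simp: convex_shape_def compact_imp_closed)
  have "rel_interior K = interior K"
    using K by (intro rel_interior_nonempty_interior) (simp add: convex_shape_def)
  with Q have "Q \<in> closure K" "Q \<notin> rel_interior K"
    by (auto simp: frontier_def)
  then show ?thesis
    using supporting_hyperplane_relative_frontier[OF conv] cK that by metis
qed

text \<open>
  If a line passes strictly between two points of \<open>K\<close>, then on this line only the two ends of the chord
  are boundary points. A support line at a point inside the chord would have to contain
  the chord, and then it could not have both points on one side.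
\<close>

lemma frontier_not_between:
  fixes K :: "(real ^ 2) set"
  assumes K: "convex_shape K"
    and P: "P \<in> K" "R \<in> K" "Q \<in> open_segment P R"
    and level: "a \<bullet> P = s" "a \<bullet> R = s"
    and X: "X \<in> K" "a \<bullet> X < s" and Y: "Y \<in> K" "s < a \<bullet> Y"
  shows "Q \<notin> frontier K"
proof
  assume Qf: "Q \<in> frontier K"
  obtain N where N0: "N \<noteq> 0" and N: "\<And>Z. Z \<in> K \<Longrightarrow> N \<bullet> Q \<le> N \<bullet> Z"
    using frontier_supporting_functional[OF K Qf] by metis
  obtain u where u: "0 < u" "u < 1" and Q: "Q = (1 - u) *\<^sub>R P + u *\<^sub>R R" and PR: "P \<noteq> R"
    using P(3) by (auto simp: in_segment)
  have "N \<bullet> Q = N \<bullet> P + u * (N \<bullet> R - N \<bullet> P)" "N \<bullet> Q = N \<bullet> R + (1 - u) * (N \<bullet> P - N \<bullet> R)"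
    by (simp_all add: Q algebra_simps)
  then have "u * (N \<bullet> R - N \<bullet> P) \<le> 0" "(1 - u) * (N \<bullet> P - N \<bullet> R) \<le> 0"
    using N[OF P(1)] N[OF P(2)] by linarith+
  then have "N \<bullet> R - N \<bullet> P = 0"
    using u by (auto simp: mult_le_0_iff)
  then have NP: "N \<bullet> (R - P) = 0" and aP: "a \<bullet> (R - P) = 0"
    using level by (auto simp: inner_diff_right)
  have a0: "a \<noteq> 0" using X Y by auto
  obtain k where k: "N = k *\<^sub>R a"
    using plane_orthogonal_parallel[of "R - P" a N] NP aP a0 PR by (auto simp: inner_commute)
  have "a \<bullet> Q = s"
    using level by (simp add: Q algebra_simps)
  then have "0 \<le> k * (a \<bullet> X - s)" "0 \<le> k * (a \<bullet> Y - s)"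
    using N[OF X(1)] N[OF Y(1)] by (auto simp: k algebra_simps)
  then show False
    using X Y k N0 by (auto simp: zero_le_mult_iff)
qed

lemma frontier_of_maximal:
  assumes "Z \<in> K" "a \<noteq> 0" and max: "\<And>P. P \<in> K \<Longrightarrow> a \<bullet> P \<le> a \<bullet> Z"
  shows "Z \<in> frontier K"
proof -
  have "Z \<notin> interior K"
  proof
    assume "Z \<in> interior K"
    then obtain r where r: "0 < r" "cball Z r \<subseteq> K"
      by (auto simp: mem_interior_cball)
    have "Z + (r / norm a) *\<^sub>R a \<in> cball Z r"
      using r(1) assms(2) by (simp add: dist_norm)
    then have "a \<bullet> (Z + (r / norm a) *\<^sub>R a) \<le> a \<bullet> Z"
      using r(2) max by blast
    then have "(r / norm a) * (a \<bullet> a) \<le> 0"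
      by (simp add: inner_add_right)
    moreover have "0 < (r / norm a) * (a \<bullet> a)"
      using r(1) assms(2) by (intro mult_pos_pos) auto
    ultimately show False by simp
  qed
  then show ?thesis
    using assms(1) closure_subset[of K] by (auto simp: frontier_def)
qed

section \<open>Linear functionals along the boundary curve\<close>

lemma boundary_curve_in_frontier:
  assumes "boundary_curve K c" "0 \<le> t" "t \<le> 1"
  shows "c t \<in> frontier K"
  using assms by (auto simp: boundary_curve_def path_image_def)

lemma boundary_curve_in_shape:
  assumes "convex_shape K" "boundary_curve K c" "0 \<le> t" "t \<le> 1"
  shows "c t \<in> K"
  using boundary_curve_in_frontier[OF assms(2-4)] assms(1) frontier_subset_closed[of K]
  by (auto simp: convex_shape_def compact_imp_closed)

lemma boundary_curve_continuous:
  assumes "boundary_curve K c" "0 \<le> p" "q \<le> 1"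
  shows "continuous_on {p..q} (\<lambda>t. a \<bullet> c t)"
proof -
  have "continuous_on {0..1} c"
    using assms by (auto simp: boundary_curve_def simple_path_def path_def)
  then have "continuous_on {p..q} c"
    by (rule continuous_on_subset) (use assms in auto)
  then show ?thesis by (intro continuous_intros)
qed

lemma boundary_curve_inj:
  assumes "boundary_curve K c" "0 < s" "s < t" "t < 1"
  shows "c s \<noteq> c t"
  using assms unfolding boundary_curve_def simple_path_def loop_free_def by force

text \<open>
  A rise, a fall and another rise would, by the intermediate value theorem, pass through a common level
  three times. That gives three distinct boundary points on a line that separates \<open>c t1\<close> from
  \<open>c t2\<close>, and the middle one contradicts \<open>frontier_not_between\<close>. The parameters of the
  three points are strictly inside \<open>{0..1}\<close>, so that the coincidence of the two ends of \<open>c\<close> does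
  no harm.
\<close>

lemma boundary_curve_no_zigzag:
  assumes K: "convex_shape K" and c: "boundary_curve K c"
    and t: "0 \<le> t0" "t0 < t1" "t1 < t2" "t2 < t3" "t3 \<le> 1"
  shows "\<not> max (a \<bullet> c t0) (a \<bullet> c t2) < min (a \<bullet> c t1) (a \<bullet> c t3)"
proof
  assume zigzag: "max (a \<bullet> c t0) (a \<bullet> c t2) < min (a \<bullet> c t1) (a \<bullet> c t3)"
  then obtain s where s: "max (a \<bullet> c t0) (a \<bullet> c t2) < s" "s < min (a \<bullet> c t1) (a \<bullet> c t3)"
    using dense by blast
  note cont = boundary_curve_continuous[OF c]
  obtain s1 where s1: "t0 \<le> s1" "s1 \<le> t1" "a \<bullet> c s1 = s"
    using IVT'[of "\<lambda>t. a \<bullet> c t" t0 s t1] cont[of t0 t1] s t by auto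
  obtain s2 where s2: "t1 \<le> s2" "s2 \<le> t2" "a \<bullet> c s2 = s"
    using IVT2'[of "\<lambda>t. a \<bullet> c t" t2 s t1] cont[of t1 t2] s t by auto
  obtain s3 where s3: "t2 \<le> s3" "s3 \<le> t3" "a \<bullet> c s3 = s"
    using IVT'[of "\<lambda>t. a \<bullet> c t" t2 s t3] cont[of t2 t3] s t by auto
  have "s1 \<noteq> t0" "s1 \<noteq> t1" "s2 \<noteq> t1" "s2 \<noteq> t2" "s3 \<noteq> t2" "s3 \<noteq> t3"
    using s s1 s2 s3 by auto
  then have ord: "0 < s1" "s1 < s2" "s2 < s3" "s3 < 1"
    using s1 s2 s3 t by linarith+
  have fr: "c s1 \<in> frontier K" "c s2 \<in> frontier K" "c s3 \<in> frontier K"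
    using boundary_curve_in_frontier[OF c] ord by auto
  have inK: "c s1 \<in> K" "c s2 \<in> K" "c s3 \<in> K" "c t1 \<in> K" "c t2 \<in> K"
    using boundary_curve_in_shape[OF K c] ord t by auto
  have ne: "c s1 \<noteq> c s2" "c s2 \<noteq> c s3" "c s1 \<noteq> c s3"
    using boundary_curve_inj[OF c] ord by auto
  have "a \<noteq> 0" using s by auto
  then obtain k where "c s3 - c s1 = k *\<^sub>R (c s2 - c s1)"
    using plane_orthogonal_parallel[of a "c s2 - c s1" "c s3 - c s1"] ne s1 s2 s3
    by (auto simp: inner_diff_right)
  then have "collinear {c s2, c s1, c s3}"
    by (subst collinear_3) (auto simp: collinear_lemma)
  then have "c s2 \<in> closed_segment (c s1) (c s3) \<or> c s1 \<in> closed_segment (c s3) (c s2)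
      \<or> c s3 \<in> closed_segment (c s2) (c s1)"
    by (simp only: collinear_between_cases between_mem_segment)
  then have "c s2 \<in> open_segment (c s1) (c s3) \<or> c s1 \<in> open_segment (c s3) (c s2)
      \<or> c s3 \<in> open_segment (c s2) (c s1)"
    using ne unfolding open_segment_def by simp
  moreover have "Q \<notin> frontier K"
    if "P \<in> K" "R \<in> K" "Q \<in> open_segment P R" "a \<bullet> P = s" "a \<bullet> R = s" for P Q R
    using frontier_not_between[OF K that, of "c t2" "c t1"] inK s by auto
  ultimately show False
    using fr inK s1 s2 s3 by blast
qed

lemma boundary_curve_no_zigzag':
  assumes K: "convex_shape K" and c: "boundary_curve K c"
    and t: "0 \<le> t0" "t0 < t1" "t1 < t2" "t2 < t3" "t3 \<le> 1"
  shows "\<not> max (a \<bullet> c t1) (a \<bullet> c t3) < min (a \<bullet> c t0) (a \<bullet> c t2)"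
  using boundary_curve_no_zigzag[OF assms, of "- a"] by auto

text \<open>
  A descent inside \<open>{p..q}\<close>, preceded by the minimum at \<open>p\<close> and followed by the maximum at \<open>q\<close>, would be
  a zigzag.
\<close>

lemma boundary_curve_mono_on:
  assumes K: "convex_shape K" and c: "boundary_curve K c" and pq: "0 \<le> p" "q \<le> 1"
    and ends: "\<And>t. p \<le> t \<Longrightarrow> t \<le> q \<Longrightarrow> a \<bullet> c p \<le> a \<bullet> c t \<and> a \<bullet> c t \<le> a \<bullet> c q"
  shows "mono_on {p..q} (\<lambda>t. a \<bullet> c t)"
proof (rule mono_onI, rule ccontr)
  fix s t assume st: "s \<in> {p..q}" "t \<in> {p..q}" "s \<le> t" and dec: "\<not> a \<bullet> c s \<le> a \<bullet> c t"
  have "s \<noteq> p" "t \<noteq> q" "s \<noteq> t"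
    using dec ends[of t] ends[of s] st by auto
  then show False
    using boundary_curve_no_zigzag[OF K c, of p s t q a] pq st dec ends[of t] ends[of s] by auto
qed

lemma boundary_curve_antimono_on:
  assumes "convex_shape K" "boundary_curve K c" "0 \<le> p" "q \<le> 1"
    and "\<And>t. p \<le> t \<Longrightarrow> t \<le> q \<Longrightarrow> a \<bullet> c q \<le> a \<bullet> c t \<and> a \<bullet> c t \<le> a \<bullet> c p"
  shows "mono_on {p..q} (\<lambda>t. - (a \<bullet> c t))"
  using boundary_curve_mono_on[of K c p q "- a"] assms by auto

text \<open>
  The curve starts at an arbitrary level, so it rises to the maximum, falls to the minimum and
  rises back to the initial level. Dropping below the initial level before the maximum, or
  exceeding it after the minimum, would produce a zigzag together with the two extrema.
\<close>

lemma functional_variation_max_first: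
  assumes K: "convex_shape K" and c: "boundary_curve K c"
    and mM: "0 \<le> u" "u \<le> v" "v \<le> 1"
    and max: "\<And>t. 0 \<le> t \<Longrightarrow> t \<le> 1 \<Longrightarrow> a \<bullet> c t \<le> a \<bullet> c u"
    and min: "\<And>t. 0 \<le> t \<Longrightarrow> t \<le> 1 \<Longrightarrow> a \<bullet> c v \<le> a \<bullet> c t"
  shows "variation_le (\<lambda>t. a \<bullet> c t) 0 1 (2 * (a \<bullet> c u - a \<bullet> c v))"
proof -
  have c10: "c 1 = c 0"
    using c by (simp add: boundary_curve_def pathfinish_def pathstart_def)
  have 1: "variation_le (\<lambda>t. a \<bullet> c t) 0 u (a \<bullet> c u - a \<bullet> c 0)"
  proof (rule variation_le_mono[OF boundary_curve_mono_on[OF K c]])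
    fix t assume t: "0 \<le> t" "t \<le> u"
    have "a \<bullet> c 0 \<le> a \<bullet> c t"
    proof (rule ccontr)
      assume low: "\<not> a \<bullet> c 0 \<le> a \<bullet> c t"
      then have "t \<noteq> 0" "t \<noteq> u" "u \<noteq> v"
        using max[of 0] min[of t] t mM by auto
      then show False
        using boundary_curve_no_zigzag'[OF K c, of 0 t u v a] low t mM min[of t] max[of 0] by auto
    qed
    then show "a \<bullet> c 0 \<le> a \<bullet> c t \<and> a \<bullet> c t \<le> a \<bullet> c u"
      using max t mM by auto
  qed (use mM in auto)
  have 2: "variation_le (\<lambda>t. a \<bullet> c t) u v (a \<bullet> c u - a \<bullet> c v)"
    by (rule variation_le_antimono[OF boundary_curve_antimono_on[OF K c]])
       (use mM max min in auto)
  have 3: "variation_le (\<lambda>t. a \<bullet> c t) v 1 (a \<bullet> c 1 - a \<bullet> c v)"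
  proof (rule variation_le_mono[OF boundary_curve_mono_on[OF K c]])
    fix t assume t: "v \<le> t" "t \<le> 1"
    have "a \<bullet> c t \<le> a \<bullet> c 1"
    proof (rule ccontr)
      assume high: "\<not> a \<bullet> c t \<le> a \<bullet> c 1"
      then have "t \<noteq> 1" "t \<noteq> v" "u \<noteq> v"
        using max[of t] min[of 1] t mM by auto
      then show False
        using boundary_curve_no_zigzag'[OF K c, of u v t 1 a] high t mM min[of 1] max[of t] by auto
    qed
    then show "a \<bullet> c v \<le> a \<bullet> c t \<and> a \<bullet> c t \<le> a \<bullet> c 1"
      using min t mM by auto
  qed (use mM in auto)
  have "variation_le (\<lambda>t. a \<bullet> c t) 0 1
      ((a \<bullet> c u - a \<bullet> c 0) + (a \<bullet> c u - a \<bullet> c v) + (a \<bullet> c 1 - a \<bullet> c v))"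
    using 1 2 3 mM by (intro variation_le_join[of _ _ v] variation_le_join[of _ _ u]) auto
  then show ?thesis
    by (rule variation_le_weaken) (simp add: c10)
qed

lemma functional_variation_le_twice_width:
  assumes K: "convex_shape K" and c: "boundary_curve K c"
    and width: "\<And>P Q. P \<in> K \<Longrightarrow> Q \<in> K \<Longrightarrow> a \<bullet> P - a \<bullet> Q \<le> W"
  shows "variation_le (\<lambda>t. a \<bullet> c t) 0 1 (2 * W)"
proof -
  have cont: "continuous_on {0..1} (\<lambda>t. a \<bullet> c t)"
    using boundary_curve_continuous[OF c] by simp
  obtain u where u: "0 \<le> u" "u \<le> 1" "\<And>t. 0 \<le> t \<Longrightarrow> t \<le> 1 \<Longrightarrow> a \<bullet> c t \<le> a \<bullet> c u"
    using continuous_attains_sup[OF _ _ cont] by auto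
  obtain v where v: "0 \<le> v" "v \<le> 1" "\<And>t. 0 \<le> t \<Longrightarrow> t \<le> 1 \<Longrightarrow> a \<bullet> c v \<le> a \<bullet> c t"
    using continuous_attains_inf[OF _ _ cont] by auto
  have "variation_le (\<lambda>t. a \<bullet> c t) 0 1 (2 * (a \<bullet> c u - a \<bullet> c v))"
  proof (cases "u \<le> v")
    case True
    then show ?thesis using functional_variation_max_first[OF K c] u v by auto
  next
    case False
    then have "variation_le (\<lambda>t. (- a) \<bullet> c t) 0 1 (2 * ((- a) \<bullet> c v - (- a) \<bullet> c u))"
      using u v by (intro functional_variation_max_first[OF K c]) auto
    then show ?thesis
      by (simp add: variation_le_def dist_minus)
  qed
  then show ?thesis
    using width[OF boundary_curve_in_shape[OF K c u(1,2)] boundary_curve_in_shape[OF K c v(1,2)]]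
    by (elim variation_le_weaken) simp
qed

section \<open>Perimeter bounds\<close>

text \<open>
  The right-hand side is the norm whose unit ball is the regular octagon inscribed in the unit disc
  with vertices at the multiples of \<open>pi / 4\<close>.
\<close>
lemma norm_le_four_projections:
  fixes x y :: real
  shows "sqrt (x\<^sup>2 + y\<^sup>2) \<le> (sqrt 2 - 1) * (\<bar>x\<bar> + \<bar>y\<bar> + \<bar>x + y\<bar> / sqrt 2 + \<bar>x - y\<bar> / sqrt 2)"
proof -
  have r2: "sqrt 2 * sqrt 2 = (2::real)" "1 < sqrt (2::real)" by auto
  have square: "2 * (r - 1) * (y * (x - y)) = (x + (r - 1) * y)\<^sup>2 - (x\<^sup>2 + y\<^sup>2)"
    if "r * r = 2" for r x y :: real
  proof -
    have "(x + (r - 1) * y)\<^sup>2 - (x\<^sup>2 + y\<^sup>2) - 2 * (r - 1) * (y * (x - y)) = (r * r - 2) * y\<^sup>2"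
      by (simp add: power2_eq_square algebra_simps)
    then show ?thesis using that by simp
  qed
  have factor: "x + (r - 1) * y = (r - 1) * (x + y + r * x)" if "r * r = 2" for r x y :: real
  proof -
    have "(r - 1) * (x + y + r * x) - (x + (r - 1) * y) = (r * r - 2) * x"
      by (simp add: algebra_simps)
    then show ?thesis using that by simp
  qed
  have *: "sqrt (x\<^sup>2 + y\<^sup>2) \<le> x + (sqrt 2 - 1) * y" if "0 \<le> y" "y \<le> x" for x y :: real
  proof (rule real_le_lsqrt)
    have "0 \<le> (2 * (sqrt 2 - 1)) * (y * (x - y))"
      using that r2 by (intro mult_nonneg_nonneg) auto
    also have "\<dots> = (x + (sqrt 2 - 1) * y)\<^sup>2 - (x\<^sup>2 + y\<^sup>2)"
      using r2(1) by (rule square)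
    finally show "x\<^sup>2 + y\<^sup>2 \<le> (x + (sqrt 2 - 1) * y)\<^sup>2" by simp
    show "0 \<le> x + (sqrt 2 - 1) * y" using that r2 by simp
  qed
  have max: "\<bar>x + y\<bar> + \<bar>x - y\<bar> = 2 * max \<bar>x\<bar> \<bar>y\<bar>" by linarith
  define M m where "M = max \<bar>x\<bar> \<bar>y\<bar>" and "m = min \<bar>x\<bar> \<bar>y\<bar>"
  have "sqrt (x\<^sup>2 + y\<^sup>2) = sqrt (M\<^sup>2 + m\<^sup>2)"
    by (simp add: M_def m_def max_def min_def)
  also have "\<dots> \<le> M + (sqrt 2 - 1) * m"
    by (rule *) (auto simp: M_def m_def)
  also have "\<dots> = (sqrt 2 - 1) * (M + m + sqrt 2 * M)"
    using r2(1) by (rule factor)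
  also have "M + m = \<bar>x\<bar> + \<bar>y\<bar>" by (simp add: M_def m_def)
  also have "sqrt 2 * M = \<bar>x + y\<bar> / sqrt 2 + \<bar>x - y\<bar> / sqrt 2"
    using max r2(1) by (simp add: M_def field_simps)
  finally show ?thesis by (simp add: algebra_simps)
qed

text \<open>
  Each of four equally spaced projections of \<open>c\<close> has variation at most twice the width of \<open>K\<close>
  in that direction, hence at most \<open>2 * W\<close>. The resulting constant is the perimeter of the regular
  octagon whose opposite sides are at distance \<open>W\<close>.
\<close>

lemma boundary_variation_le_octagon:
  assumes K: "convex_shape K" and c: "boundary_curve K c"
    and diam: "\<And>P Q. P \<in> K \<Longrightarrow> Q \<in> K \<Longrightarrow> dist P Q \<le> W"
  shows "variation_le c 0 1 (8 * (sqrt 2 - 1) * W)"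
proof -
  define v :: "nat \<Rightarrow> real ^ 2" where
    "v i = (if i = 0 then vector [1, 0] else if i = 1 then vector [0, 1]
       else if i = 2 then vector [1 / sqrt 2, 1 / sqrt 2] else vector [1 / sqrt 2, - 1 / sqrt 2])" for i
  have norm_v: "norm (v i) = 1" for i
    by (simp add: v_def norm_eq_sqrt_inner inner_vec_def sum_2 power2_eq_square)
  have "variation_le c 0 1 (\<Sum>i<4::nat. (sqrt 2 - 1) * (2 * W))"
  proof (rule variation_le_sum[where h = "\<lambda>i t. v i \<bullet> c t"])
    show "variation_le (\<lambda>t. v i \<bullet> c t) 0 1 (2 * W)" for i
    proof (rule functional_variation_le_twice_width[OF K c])
      fix P Q assume PQ: "P \<in> K" "Q \<in> K"
      have "v i \<bullet> P - v i \<bullet> Q \<le> norm (v i) * norm (P - Q)"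
        by (metis inner_diff_right norm_cauchy_schwarz)
      then show "v i \<bullet> P - v i \<bullet> Q \<le> W"
        using diam[OF PQ] by (simp add: norm_v dist_norm)
    qed
    show "dist (c s) (c t) \<le> (\<Sum>i<4. (sqrt 2 - 1) * dist (v i \<bullet> c s) (v i \<bullet> c t))" for s t
    proof -
      define z where "z = c s - c t"
      have d: "dist (v i \<bullet> c s) (v i \<bullet> c t) = \<bar>v i \<bullet> z\<bar>" for i
        by (simp add: dist_real_def z_def inner_diff_right)
      have "dist (c s) (c t) = sqrt ((z$1)\<^sup>2 + (z$2)\<^sup>2)"
        by (simp add: dist_norm z_def norm_eq_sqrt_inner inner_vec_def sum_2 power2_eq_square)
      also have "\<dots> \<le> (sqrt 2 - 1) *
          (\<bar>z$1\<bar> + \<bar>z$2\<bar> + \<bar>z$1 + z$2\<bar> / sqrt 2 + \<bar>z$1 - z$2\<bar> / sqrt 2)"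
        by (rule norm_le_four_projections)
      also have "\<dots> = (\<Sum>i<4. (sqrt 2 - 1) * \<bar>v i \<bullet> z\<bar>)"
      proof -
        have "v 2 \<bullet> z = (z$1 + z$2) / sqrt 2" "v 3 \<bullet> z = (z$1 - z$2) / sqrt 2"
          "v 0 \<bullet> z = z$1" "v 1 \<bullet> z = z$2"
          by (auto simp: v_def inner_vec_def sum_2 field_simps)
        then show ?thesis
          by (simp add: sum_distrib_left[symmetric] eval_nat_numeral add_ac)
      qed
      finally show ?thesis by (simp add: d)
    qed
  qed auto
  then show ?thesis
    by (rule variation_le_weaken) (simp add: algebra_simps)
qed

text \<open>
  In the coordinates with origin \<open>M\<close> and axes \<open>e\<close>, \<open>n\<close>, this is the support line of slope \<open>m\<close> at the
  point \<open>(0, b)\<close>. It is not vertical because \<open>K\<close> has points on both sides of the \<open>n\<close>-axis and lies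
  below it because of \<open>(0, -d)\<close>; the points \<open>(-w, 0)\<close> and \<open>(w, 0)\<close>, not above the line, limit its slope.
\<close>

lemma supporting_slope:
  fixes K :: "(real ^ 2) set"
  assumes K: "convex_shape K" and B: "M + b *\<^sub>R n \<in> frontier K"
    and en: "norm e = 1" "norm n = 1" "e \<bullet> n = 0"
    and AC: "M - w *\<^sub>R e \<in> K" "M + w *\<^sub>R e \<in> K" and D: "M - d *\<^sub>R n \<in> K"
    and pos: "0 < w" "0 < b + d"
  obtains m where "\<bar>m\<bar> * w \<le> b" "\<And>Z. Z \<in> K \<Longrightarrow> n \<bullet> (Z - M) - m * (e \<bullet> (Z - M)) \<le> b"
proof -
  obtain N where N0: "N \<noteq> 0" and N: "\<And>Z. Z \<in> K \<Longrightarrow> N \<bullet> (M + b *\<^sub>R n) \<le> N \<bullet> Z"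
    using frontier_supporting_functional[OF K B] by metis
  define n1 n2 where "n1 = e \<bullet> N" and "n2 = n \<bullet> N"
  have ee: "e \<bullet> e = 1" "n \<bullet> n = 1" "n \<bullet> e = 0"
    using en by (auto simp: norm_eq_1 inner_commute)
  have N': "n2 * b \<le> n1 * (e \<bullet> (Z - M)) + n2 * (n \<bullet> (Z - M))" if "Z \<in> K" for Z
  proof -
    have "N \<bullet> (Z - M) = n1 * (e \<bullet> (Z - M)) + n2 * (n \<bullet> (Z - M))"
      unfolding n1_def n2_def by (rule plane_orthonormal_inner[OF en])
    then show ?thesis
      using N[OF that] by (simp add: n2_def algebra_simps inner_commute[of N n])
  qed
  have 1: "n2 * b \<le> - (n1 * w)" "n2 * b \<le> n1 * w" "n2 * b \<le> - (n2 * d)"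
    using N'[OF AC(1)] N'[OF AC(2)] N'[OF D] en ee by simp_all
  have "n2 * (b + d) \<le> 0" using 1 by (simp add: algebra_simps)
  then have "n2 \<le> 0" using pos by (simp add: mult_le_0_iff)
  moreover have "n2 \<noteq> 0"
  proof
    assume "n2 = 0"
    then have "n1 * w = 0" using 1 by simp
    then have "N \<bullet> N = 0"
      using \<open>n2 = 0\<close> pos plane_orthonormal_inner[OF en, of N N] by (simp add: n1_def n2_def)
    then show False using N0 by simp
  qed
  ultimately have n2: "n2 < 0" by simp
  show ?thesis
  proof
    have "\<bar>n1\<bar> * w \<le> - n2 * b" using 1 by (auto simp: abs_if)
    then show "\<bar>- n1 / n2\<bar> * w \<le> b" using n2 by (simp add: field_simps)
    show "n \<bullet> (Z - M) - (- n1 / n2) * (e \<bullet> (Z - M)) \<le> b" if "Z \<in> K" for Z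
      using N'[OF that] n2 by (simp add: field_simps)
  qed
qed

text \<open>
  The arc from \<open>(-w, 0)\<close> over \<open>(0, b)\<close> to \<open>(w, 0)\<close> is compared with the outer broken line made of two
  vertical segments and the support line \<open>y = b + m * x\<close>. A step \<open>(\<Delta>x, \<Delta>y)\<close> is split
  into a step along the support line and a vertical one of height \<open>\<Delta>y - m * \<Delta>x\<close>. The abscissa is monotone on the
  whole arc, and \<open>\<phi> = y - m * x\<close> is monotone on each half. That on each half \<open>\<phi>\<close> never
  drops below its value at the outer end follows from the fact that the arc runs above its two chords to \<open>(0, b)\<close>. The point \<open>(0, -d)\<close>
  on the other arc is there to rule out the arc crossing one of these chords.
\<close>

lemma half_boundary_variation:
  fixes K :: "(real ^ 2) set"
  assumes K: "convex_shape K" and c: "boundary_curve K c"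
    and par: "0 \<le> p" "p < \<beta>" "\<beta> < q" "q \<le> 1" "0 \<le> r" "r \<le> 1" "r < p \<or> q < r"
    and en: "norm e = 1" "norm n = 1" "e \<bullet> n = 0"
    and points: "c p = M - w *\<^sub>R e" "c q = M + w *\<^sub>R e" "c \<beta> = M + b *\<^sub>R n" "c r = M - d *\<^sub>R n"
    and pos: "0 < w" "0 < b + d"
    and strip: "\<And>Z. Z \<in> K \<Longrightarrow> \<bar>e \<bullet> (Z - M)\<bar> \<le> w"
  shows "variation_le c p q (2 * sqrt (w\<^sup>2 + b\<^sup>2) + 2 * b)"
proof -
  have ee: "e \<bullet> e = 1" "n \<bullet> n = 1" "n \<bullet> e = 0"
    using en by (auto simp: norm_eq_1 inner_commute)
  have inK: "c t \<in> K" if "0 \<le> t" "t \<le> 1" for t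
    using boundary_curve_in_shape[OF K c that] .
  obtain m where m: "\<bar>m\<bar> * w \<le> b"
    and supp: "\<And>Z. Z \<in> K \<Longrightarrow> n \<bullet> (Z - M) - m * (e \<bullet> (Z - M)) \<le> b"
    using supporting_slope[of K M b n e w d] K boundary_curve_in_frontier[OF c, of \<beta>] inK[of p] inK[of q] inK[of r]
      par en pos points by auto
  have mw: "m * w \<le> b" "- (m * w) \<le> b"
    using m pos abs_le_iff[of "m * w" b] by (simp_all add: abs_mult)
  define x y where "x t = e \<bullet> (c t - M)" and "y t = n \<bullet> (c t - M)" for t
  have x: "x p = - w" "x q = w" "x \<beta> = 0" "x r = 0" and y: "y p = 0" "y q = 0" "y \<beta> = b" "y r = - d"
    using en ee by (simp_all add: x_def y_def points)
  have xw: "\<bar>x t\<bar> \<le> w" if "p \<le> t" "t \<le> q" for t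
    using strip inK[of t] that par by (simp add: x_def)
  have combo: "(k *\<^sub>R n + l *\<^sub>R e) \<bullet> c t = k * y t + l * x t + (k *\<^sub>R n + l *\<^sub>R e) \<bullet> M" for k l t
    by (simp add: x_def y_def algebra_simps)
  have zigzag: "\<not> max (k * y t0 + l * x t0) (k * y t2 + l * x t2) < min (k * y t1 + l * x t1) (k * y t3 + l * x t3)"
    and zigzag': "\<not> max (k * y t1 + l * x t1) (k * y t3 + l * x t3) < min (k * y t0 + l * x t0) (k * y t2 + l * x t2)"
    if "0 \<le> t0" "t0 < t1" "t1 < t2" "t2 < t3" "t3 \<le> 1" for k l t0 t1 t2 t3
    using boundary_curve_no_zigzag[OF K c that, of "k *\<^sub>R n + l *\<^sub>R e"]
      boundary_curve_no_zigzag'[OF K c that, of "k *\<^sub>R n + l *\<^sub>R e"]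
    unfolding combo max_add_distrib_left[symmetric] min_add_distrib_left[symmetric] add_less_cancel_right
    by simp_all
  \<comment> \<open>height above the line through \<open>M\<close> parallel to the support line\<close>
  define \<phi> where "\<phi> t = y t - m * x t" for t
  have phi: "\<phi> t = (1 *\<^sub>R n + (- m) *\<^sub>R e) \<bullet> c t - (1 *\<^sub>R n + (- m) *\<^sub>R e) \<bullet> M" for t
    by (subst combo) (simp add: \<phi>_def)
  have \<phi>_le: "\<phi> t \<le> \<phi> \<beta>" if "p \<le> t" "t \<le> q" for t
    using supp[OF inK[of t]] that par x y by (simp add: \<phi>_def x_def y_def)
  have \<phi>p: "\<phi> p \<le> \<phi> t" if t: "p \<le> t" "t \<le> \<beta>" for t
  proof -
    \<comment> \<open>the arc from \<open>c p\<close> to \<open>c \<beta>\<close> stays above its chord; otherwise the functional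
        constant on the chord, together with its low value at \<open>c r\<close>, zigzags\<close>
    have "b * w \<le> w * y t - b * x t"
    proof (rule ccontr)
      assume "\<not> b * w \<le> w * y t - b * x t"
      moreover then have "t \<noteq> p" "t \<noteq> \<beta>" using x y by (auto simp: mult.commute)
      moreover have "w * y r - b * x r < b * w"
        using mult_pos_pos[OF pos] by (simp add: x y algebra_simps)
      ultimately show False
        using zigzag'[of p t \<beta> r w "- b"] zigzag[of r p t \<beta> w "- b"] t par x y
        by (auto simp: mult.commute)
    qed
    moreover have "0 \<le> (b - m * w) * (x t + w)"
      using mw xw[of t] t par by (intro mult_nonneg_nonneg) auto
    ultimately have "w * \<phi> p \<le> w * \<phi> t"
      by (simp add: \<phi>_def x y algebra_simps)
    then show ?thesis using pos by simp
  qed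
  have \<phi>q: "\<phi> q \<le> \<phi> t" if t: "\<beta> \<le> t" "t \<le> q" for t
  proof -
    have "b * w \<le> w * y t + b * x t"
    proof (rule ccontr)
      assume "\<not> b * w \<le> w * y t + b * x t"
      moreover then have "t \<noteq> q" "t \<noteq> \<beta>" using x y by (auto simp: mult.commute)
      moreover have "w * y r + b * x r < b * w"
        using mult_pos_pos[OF pos] by (simp add: x y algebra_simps)
      ultimately show False
        using zigzag'[of \<beta> t q r w b] zigzag[of r \<beta> t q w b] t par x y
        by (auto simp: mult.commute)
    qed
    moreover have "0 \<le> (b + m * w) * (w - x t)"
      using mw xw[of t] t par by (intro mult_nonneg_nonneg) auto
    ultimately have "w * \<phi> q \<le> w * \<phi> t"
      by (simp add: \<phi>_def x y algebra_simps)
    then show ?thesis using pos by simp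
  qed
  have "variation_le \<phi> p \<beta> (\<phi> \<beta> - \<phi> p)"
  proof (rule variation_le_mono)
    have "mono_on {p..\<beta>} (\<lambda>t. (1 *\<^sub>R n + (- m) *\<^sub>R e) \<bullet> c t)"
      using boundary_curve_mono_on[OF K c, of p \<beta>] par \<phi>p \<phi>_le unfolding phi by auto
    then show "mono_on {p..\<beta>} \<phi>" unfolding phi mono_on_def by simp
  qed simp
  moreover have "variation_le \<phi> \<beta> q (\<phi> \<beta> - \<phi> q)"
  proof (rule variation_le_antimono)
    have "mono_on {\<beta>..q} (\<lambda>t. - ((1 *\<^sub>R n + (- m) *\<^sub>R e) \<bullet> c t))"
      using boundary_curve_antimono_on[OF K c, of \<beta> q] par \<phi>q \<phi>_le unfolding phi by auto
    then show "mono_on {\<beta>..q} (\<lambda>t. - \<phi> t)" unfolding phi mono_on_def by simp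
  qed simp
  ultimately have var\<phi>: "variation_le \<phi> p q (2 * b)"
    using variation_le_join[of \<phi> p \<beta> _ q] par by (fastforce simp: \<phi>_def x y)
  have varx: "variation_le x p q (2 * w)"
  proof (rule variation_le_mono)
    have "mono_on {p..q} (\<lambda>t. e \<bullet> c t)"
      using boundary_curve_mono_on[OF K c, of p q e] par xw x
      by (fastforce simp: x_def inner_diff_right abs_le_iff)
    then show "mono_on {p..q} x" by (auto simp: x_def mono_on_def inner_diff_right)
  qed (simp add: x)
  have "variation_le c p q (\<Sum>i\<in>UNIV. (if i then sqrt (1 + m\<^sup>2) else 1) * (if i then 2 * w else 2 * b))"
  proof (rule variation_le_sum[where h = "\<lambda>i. if i then x else \<phi>"])
    show "variation_le (if i then x else \<phi>) p q (if i then 2 * w else 2 * b)" for i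
      using varx var\<phi> by simp
    fix s t
    define X Y where "X = x s - x t" and "Y = \<phi> s - \<phi> t"
    have "dist (c s) (c t) = sqrt (X\<^sup>2 + (m * X + Y)\<^sup>2)"
      using plane_orthonormal_norm[OF en, of "c s - c t"]
      by (simp add: dist_norm X_def Y_def \<phi>_def x_def y_def algebra_simps)
    also have "\<dots> \<le> sqrt (X\<^sup>2 + (m * X)\<^sup>2) + sqrt (0\<^sup>2 + Y\<^sup>2)"
      using real_sqrt_sum_squares_triangle_ineq[of X 0 "m * X" Y] by simp
    also have "\<dots> = sqrt (1 + m\<^sup>2) * \<bar>X\<bar> + \<bar>Y\<bar>"
      by (simp add: power_mult_distrib real_sqrt_mult[symmetric] flip: real_sqrt_abs) (simp add: algebra_simps)
    finally show "dist (c s) (c t) \<le> (\<Sum>i\<in>UNIV. (if i then sqrt (1 + m\<^sup>2) else 1)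
        * dist ((if i then x else \<phi>) s) ((if i then x else \<phi>) t))"
      by (simp add: UNIV_bool X_def Y_def dist_real_def)
  qed auto
  moreover have "sqrt (1 + m\<^sup>2) * w \<le> sqrt (w\<^sup>2 + b\<^sup>2)"
  proof -
    have "sqrt (1 + m\<^sup>2) * w = sqrt (w\<^sup>2 + (\<bar>m\<bar> * w)\<^sup>2)"
    proof -
      have "w\<^sup>2 + (\<bar>m\<bar> * w)\<^sup>2 = (1 + m\<^sup>2) * w\<^sup>2"
        by (simp add: power_mult_distrib algebra_simps)
      then show ?thesis using pos by (simp add: real_sqrt_mult)
    qed
    also have "\<dots> \<le> sqrt (w\<^sup>2 + b\<^sup>2)"
      using m pos by (intro real_sqrt_le_mono add_left_mono power_mono) auto
    finally show ?thesis .
  qed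
  ultimately show ?thesis
    by (elim variation_le_weaken) (simp add: UNIV_bool)
qed

section \<open>The kite inscribed along a diameter\<close>

text \<open>
  The labels \<open>B\<close> and \<open>D\<close> are attached by the two arcs of the boundary curve between \<open>A\<close> and \<open>C\<close>,
  and the normal direction \<open>n\<close> is chosen to point from \<open>D\<close> to \<open>B\<close>. That the two points lie on
  different sides of \<open>A C\<close> is then a consequence: otherwise one of them would lie strictly between the
  midpoint \<open>M\<close>, which belongs to \<open>K\<close>, and the other one.
\<close>
lemma diameter_and_perpendicular_bisector:
  assumes K: "convex_shape K"
  obtains A B C D w b d where
    "{A, B, C, D} \<subseteq> frontier K" "0 < w" "0 \<le> b" "0 \<le> d" "0 < b + d"
    "dist A C = 2 * w" "dist B D = b + d"
    "dist A B = sqrt (w\<^sup>2 + b\<^sup>2)" "dist B C = sqrt (w\<^sup>2 + b\<^sup>2)"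
    "dist A D = sqrt (w\<^sup>2 + d\<^sup>2)" "dist C D = sqrt (w\<^sup>2 + d\<^sup>2)"
    "\<And>P Q. P \<in> K \<Longrightarrow> Q \<in> K \<Longrightarrow> dist P Q \<le> 2 * w"
    "perimeter K \<le> ennreal (2 * (sqrt (w\<^sup>2 + b\<^sup>2) + sqrt (w\<^sup>2 + d\<^sup>2) + (b + d)))"
    "perimeter K \<le> ennreal (8 * (sqrt 2 - 1) * (2 * w))"
proof -
  have cpt: "compact K" and conv: "convex K" and int: "interior K \<noteq> {}"
    using K by (auto simp: convex_shape_def)
  have bdd: "bounded K" using cpt by (rule compact_imp_bounded)
  have "K \<noteq> {}" using int by auto
  then obtain A C where AC: "A \<in> K" "C \<in> K" "dist A C = diameter K"
    using diameter_compact_attained[OF cpt] by blast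
  define w where "w = dist A C / 2"
  have diam: "dist P Q \<le> 2 * w" if "P \<in> K" "Q \<in> K" for P Q
    using diameter_bounded_bound[OF bdd that] AC by (simp add: w_def)
  have "A \<noteq> C"
  proof
    assume "A = C"
    then have "K \<subseteq> {A}" using diam AC by (force simp: w_def)
    then have "interior K \<subseteq> interior {A}" by (rule interior_mono)
    then show False using int by simp
  qed
  then have w: "0 < w" by (simp add: w_def)
  define M where "M = (1/2) *\<^sub>R (A + C)"
  define e where "e = (1 / (2 * w)) *\<^sub>R (C - A)"
  have we: "w *\<^sub>R e = (1/2) *\<^sub>R (C - A)"
    using w by (simp add: e_def)
  have A: "A = M - w *\<^sub>R e" and C: "C = M + w *\<^sub>R e"
    unfolding we M_def by (simp_all add: vec_eq_iff field_simps)
  have e1: "norm e = 1"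
    using w by (simp add: e_def w_def dist_norm norm_minus_commute)
  then have ee: "e \<bullet> e = 1" by (simp add: norm_eq_1)
  have strip: "\<bar>e \<bullet> (Z - M)\<bar> \<le> w" if Z: "Z \<in> K" for Z
  proof -
    have "e \<bullet> (C - Z) \<le> norm e * norm (C - Z)" "e \<bullet> (Z - A) \<le> norm e * norm (Z - A)"
      by (rule norm_cauchy_schwarz)+
    then have "e \<bullet> (C - Z) \<le> 2 * w" "e \<bullet> (Z - A) \<le> 2 * w"
      using diam[OF Z AC(1)] diam[OF AC(2) Z] by (simp_all add: e1 dist_norm)
    then show ?thesis by (simp add: A C algebra_simps ee abs_le_iff)
  qed
  have "A \<in> frontier K"
  proof (rule frontier_of_maximal[OF AC(1)])
    show "- e \<noteq> 0" using e1 by auto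
    show "- e \<bullet> P \<le> - e \<bullet> A" if "P \<in> K" for P
      using strip[OF that] by (simp add: A abs_le_iff algebra_simps ee)
  qed
  have "C \<in> frontier K"
  proof (rule frontier_of_maximal[OF AC(2)])
    show "e \<noteq> 0" using e1 by auto
    show "e \<bullet> P \<le> e \<bullet> C" if "P \<in> K" for P
      using strip[OF that] by (simp add: C abs_le_iff algebra_simps ee)
  qed
  \<comment> \<open>the parametrization that defines the perimeter, and its shift to the starting point \<open>A\<close>\<close>
  define c0 where "c0 = (SOME c. boundary_curve K c)"
  have c0: "boundary_curve K c0"
    unfolding c0_def using boundary_curve_exists[OF K] by (rule someI_ex)
  have per: "perimeter K = curve_length c0" by (simp add: perimeter_def c0_def)
  have "A \<in> c0 ` {0..1}"
    using c0 \<open>A \<in> frontier K\<close> by (simp add: boundary_curve_def path_image_def)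
  then obtain a where a: "0 \<le> a" "a \<le> 1" "c0 a = A" by auto
  define c where "c = shiftpath a c0"
  have closed0: "pathfinish c0 = pathstart c0" using c0 by (simp add: boundary_curve_def)
  have c: "boundary_curve K c"
    using c0 a by (simp add: boundary_curve_def c_def simple_path_shiftpath path_image_shiftpath closed_shiftpath)
  have c_ends: "c 0 = A" "c 1 = A"
    using pathstart_shiftpath[OF a(2), of c0] pathfinish_shiftpath[OF a(1) closed0] a(3)
    by (simp_all add: c_def pathstart_def pathfinish_def)
  have "C \<in> c ` {0..1}"
    using c \<open>C \<in> frontier K\<close> by (simp add: boundary_curve_def path_image_def)
  then obtain \<tau> where \<tau>: "0 \<le> \<tau>" "\<tau> \<le> 1" "c \<tau> = C" by auto
  then have \<tau>': "0 < \<tau>" "\<tau> < 1"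
    using \<open>A \<noteq> C\<close> c_ends by (auto simp: less_le)
  have levels: "e \<bullet> A < e \<bullet> M" "e \<bullet> M < e \<bullet> C"
    using w by (simp_all add: A C algebra_simps ee)
  obtain \<beta> where \<beta>: "0 \<le> \<beta>" "\<beta> \<le> \<tau>" "e \<bullet> c \<beta> = e \<bullet> M"
    using IVT'[of "\<lambda>t. e \<bullet> c t" 0 "e \<bullet> M" \<tau>] boundary_curve_continuous[OF c, of 0 \<tau> e] \<tau> c_ends levels
    by auto
  obtain \<delta> where \<delta>: "\<tau> \<le> \<delta>" "\<delta> \<le> 1" "e \<bullet> c \<delta> = e \<bullet> M"
    using IVT2'[of "\<lambda>t. e \<bullet> c t" 1 "e \<bullet> M" \<tau>] boundary_curve_continuous[OF c, of \<tau> 1 e] \<tau> c_ends levels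
    by auto
  have "\<beta> \<noteq> 0" "\<beta> \<noteq> \<tau>" "\<delta> \<noteq> \<tau>" "\<delta> \<noteq> 1"
    using \<beta> \<delta> \<tau> c_ends levels by auto
  then have ord: "0 < \<beta>" "\<beta> < \<tau>" "\<tau> < \<delta>" "\<delta> < 1"
    using \<beta> \<delta> by linarith+
  define B D where "B = c \<beta>" and "D = c \<delta>"
  have BDf: "B \<in> frontier K" "D \<in> frontier K" and BDK: "B \<in> K" "D \<in> K"
    using boundary_curve_in_frontier[OF c] boundary_curve_in_shape[OF K c] ord by (auto simp: B_def D_def)
  have "B \<noteq> D" using boundary_curve_inj[OF c, of \<beta> \<delta>] ord by (simp add: B_def D_def)
  define n where "n = (1 / norm (B - D)) *\<^sub>R (B - D)"
  have n1: "norm n = 1" using \<open>B \<noteq> D\<close> by (simp add: n_def)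
  have en: "e \<bullet> n = 0" using \<beta> \<delta> by (simp add: n_def B_def D_def inner_diff_right)
  define b d where "b = n \<bullet> (B - M)" and "d = - (n \<bullet> (D - M))"
  have B: "B = M + b *\<^sub>R n" and D: "D = M - d *\<^sub>R n"
    using plane_orthonormal_expansion[OF e1 n1 en, of "B - M"]
      plane_orthonormal_expansion[OF e1 n1 en, of "D - M"] \<beta>(3) \<delta>(3)
    by (simp_all add: b_def d_def B_def D_def inner_diff_right algebra_simps)
  have "b + d = n \<bullet> (B - D)" by (simp add: b_def d_def algebra_simps)
  also have "\<dots> = norm (B - D)"
    using \<open>B \<noteq> D\<close> by (simp add: n_def dot_square_norm power2_eq_square)
  finally have bd: "b + d = norm (B - D)" .
  then have bd_pos: "0 < b + d" using \<open>B \<noteq> D\<close> by simp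
  have "M \<in> K"
    using convexD[OF conv AC(1,2), of "1/2" "1/2"] by (simp add: M_def scaleR_add_right)
  have between: "M + u *\<^sub>R (Z - M) \<notin> frontier K"
    if "0 < u" "u < 1" "Z \<in> K" "e \<bullet> Z = e \<bullet> M" "Z \<noteq> M" for u Z
  proof (rule frontier_not_between[OF K \<open>M \<in> K\<close> \<open>Z \<in> K\<close>, of _ e "e \<bullet> M" A C])
    show "M + u *\<^sub>R (Z - M) \<in> open_segment M Z"
      using that by (auto simp: in_segment algebra_simps intro!: exI[of _ u])
  qed (use that AC levels in auto)
  have b: "0 \<le> b"
  proof (rule ccontr)
    assume "\<not> 0 \<le> b"
    then have "0 < d" "0 < - b / d" "- b / d < 1" using bd_pos by (auto simp: field_simps)
    moreover have "B = M + (- b / d) *\<^sub>R (D - M)"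
      using \<open>0 < d\<close> by (simp add: B D)
    moreover have "D \<noteq> M" using \<open>0 < d\<close> n1 by (auto simp: D)
    ultimately show False
      using between[of "- b / d" D] BDf BDK \<delta>(3) by (simp add: D_def)
  qed
  have d: "0 \<le> d"
  proof (rule ccontr)
    assume "\<not> 0 \<le> d"
    then have "0 < b" "0 < - d / b" "- d / b < 1" using bd_pos by (auto simp: field_simps)
    moreover have "D = M + (- d / b) *\<^sub>R (B - M)"
      using \<open>0 < b\<close> by (simp add: B D)
    moreover have "B \<noteq> M" using \<open>0 < b\<close> n1 by (auto simp: B)
    ultimately show False
      using between[of "- d / b" B] BDf BDK \<beta>(3) by (simp add: B_def)
  qed
  have dist_eq: "dist (M + x *\<^sub>R e + y *\<^sub>R n) (M + x' *\<^sub>R e + y' *\<^sub>R n) = sqrt ((x - x')\<^sup>2 + (y - y')\<^sup>2)"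
    for x y x' y'
    using e1 n1 en unfolding dist_norm plane_orthonormal_norm[OF e1 n1 en]
    by (simp add: algebra_simps ee norm_eq_1 inner_commute[of n e])
  have dists: "dist A B = sqrt (w\<^sup>2 + b\<^sup>2)" "dist B C = sqrt (w\<^sup>2 + b\<^sup>2)"
    "dist A D = sqrt (w\<^sup>2 + d\<^sup>2)" "dist C D = sqrt (w\<^sup>2 + d\<^sup>2)"
    using dist_eq[of "- w" 0 0 b] dist_eq[of 0 b w 0] dist_eq[of "- w" 0 0 "- d"] dist_eq[of w 0 0 "- d"]
    by (simp_all add: A B C D)
  have "variation_le c 0 \<tau> (2 * sqrt (w\<^sup>2 + b\<^sup>2) + 2 * b)"
    using ord c_ends A B C D \<tau> e1 n1 en w bd_pos strip
    by (intro half_boundary_variation[OF K c, where \<beta> = \<beta> and r = \<delta> and e = e and n = n and M = M and d = d])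
       (auto simp: B_def D_def)
  \<comment> \<open>the other half is the same statement after a rotation by a half-turn\<close>
  moreover have "variation_le c \<tau> 1 (2 * sqrt (w\<^sup>2 + d\<^sup>2) + 2 * d)"
    using ord c_ends A B C D \<tau> e1 n1 en w bd_pos strip
    by (intro half_boundary_variation[OF K c, where \<beta> = \<delta> and r = \<beta> and e = "- e" and n = "- n" and M = M and d = b])
       (auto simp: B_def D_def add.commute)
  ultimately have "variation_le c 0 1 ((2 * sqrt (w\<^sup>2 + b\<^sup>2) + 2 * b) + (2 * sqrt (w\<^sup>2 + d\<^sup>2) + 2 * d))"
    by (rule variation_le_join) (use \<tau> in auto)
  then have "variation_le c 0 1 (2 * (sqrt (w\<^sup>2 + b\<^sup>2) + sqrt (w\<^sup>2 + d\<^sup>2) + (b + d)))"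
    by (rule variation_le_weaken) simp
  then have "variation_le c0 0 1 (2 * (sqrt (w\<^sup>2 + b\<^sup>2) + sqrt (w\<^sup>2 + d\<^sup>2) + (b + d)))"
    unfolding c_def using closed0 a by (intro variation_le_shiftpath[of c0 a]) auto
  then have per1: "perimeter K \<le> ennreal (2 * (sqrt (w\<^sup>2 + b\<^sup>2) + sqrt (w\<^sup>2 + d\<^sup>2) + (b + d)))"
    unfolding per by (rule curve_length_le_variation)
  have per2: "perimeter K \<le> ennreal (8 * (sqrt 2 - 1) * (2 * w))"
    unfolding per by (intro curve_length_le_variation boundary_variation_le_octagon[OF K c0] diam)
  show ?thesis
    by (rule that[of A B C D w b d])
      (use \<open>A \<in> frontier K\<close> \<open>C \<in> frontier K\<close> BDf w b d bd bd_pos dists diam per1 per2 in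
        \<open>auto simp: w_def dist_norm[of B D]\<close>)
qed

text \<open>
  The assumption says that \<open>w\<^sup>2 < b\<^sup>2 + 2 * b * d\<close>. For \<open>w = 1\<close> the right-hand side has, under
  this constraint, a minimum of about \<open>3.330\<close> near \<open>b = 0.79\<close>, \<open>d = 0.24\<close>, whereas
  \<open>8 * (sqrt 2 - 1) < 3.3138\<close>. The square roots are bounded below by their tangents with slopes
  close to those at the minimum, and the remaining linear expression by the arithmetic-geometric mean
  inequality.
\<close>

lemma two_short_sides_and_long_side:
  fixes w b d :: real
  assumes w: "0 < w" and b: "0 \<le> b" and d: "0 \<le> d" and short: "sqrt (w\<^sup>2 + d\<^sup>2) < b + d"
  shows "8 * (sqrt 2 - 1) * w \<le> 2 * sqrt (w\<^sup>2 + d\<^sup>2) + sqrt (w\<^sup>2 + b\<^sup>2)"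
proof -
  have "w\<^sup>2 + d\<^sup>2 < (b + d)\<^sup>2"
    using short b d by (metis add_nonneg_nonneg real_sqrt_less_iff real_sqrt_pow2_iff real_sqrt_unique)
  then have gap: "w\<^sup>2 < b\<^sup>2 + 2 * (b * d)"
    by (simp add: power2_sum)
  have bpos: "0 < b"
    using b gap w by (cases "b = 0") auto
  \<comment> \<open>tangent at \<open>d = w / 4\<close>, with \<open>2 / sqrt 17\<close> rounded down to \<open>97 / 200\<close>\<close>
  have "97/200 * (4 * w + d) \<le> 2 * sqrt (w\<^sup>2 + d\<^sup>2)"
  proof -
    have "(4 * w + d)\<^sup>2 \<le> 17 * (w\<^sup>2 + d\<^sup>2)"
      using zero_le_power2[of "w - 4 * d"] by (simp add: power2_eq_square algebra_simps)
    then have "(97/400)\<^sup>2 * (4 * w + d)\<^sup>2 \<le> (97/400)\<^sup>2 * (17 * (w\<^sup>2 + d\<^sup>2))"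
      by (intro mult_left_mono) auto
    also have "\<dots> \<le> w\<^sup>2 + d\<^sup>2"
      by (simp add: power2_eq_square)
    finally have "97/400 * (4 * w + d) \<le> sqrt (w\<^sup>2 + d\<^sup>2)"
      by (intro real_le_rsqrt) (simp only: power_mult_distrib)
    then show ?thesis by simp
  qed
  \<comment> \<open>tangent at \<open>b = 3 * w / 4\<close>\<close>
  moreover have "(4 * w + 3 * b) / 5 \<le> sqrt (w\<^sup>2 + b\<^sup>2)"
    using zero_le_power2[of "3 * w - 4 * b"]
    by (intro real_le_rsqrt) (simp add: power2_eq_square algebra_simps)
  \<comment> \<open>the two tangents contribute \<open>2.74 * w\<close>; this is what is missing to \<open>3.3138 * w\<close>\<close>
  moreover have "2869/5000 * w \<le> 97/200 * d + 3/5 * b"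
  proof -
    \<comment> \<open>the square is nearly the arithmetic-geometric mean inequality for the two summands
        left after \<open>b * d\<close> is eliminated by \<open>gap\<close>; the other terms absorb the rounding\<close>
    have "0 \<le> 97/400 * (w - 6/5 * b)\<^sup>2 + 41/5000 * (w * b) + 83/10000 * b\<^sup>2"
      using w b by (intro add_nonneg_nonneg mult_nonneg_nonneg) auto
    also have "\<dots> = 97/400 * (w\<^sup>2 - b\<^sup>2) + 3/5 * b\<^sup>2 - 2869/5000 * (w * b)"
      by (simp add: power2_eq_square field_simps)
    also have "\<dots> \<le> b * (97/200 * d + 3/5 * b - 2869/5000 * w)"
      using gap by (simp add: power2_eq_square algebra_simps)
    finally show ?thesis
      using bpos by (simp add: zero_le_mult_iff)
  qed
  ultimately have "20711/6250 * w \<le> 2 * sqrt (w\<^sup>2 + d\<^sup>2) + sqrt (w\<^sup>2 + b\<^sup>2)"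
    using w by argo
  moreover have "8 * (sqrt 2 - 1) * w \<le> 20711/6250 * w"
  proof -
    have "sqrt 2 \<le> 70711/50000" by (rule real_le_lsqrt) (auto simp: power2_eq_square)
    then show ?thesis using w by simp
  qed
  ultimately show ?thesis by simp
qed

section \<open>Curves through the four points\<close>

lemma curve_length_ge_three_chords:
  assumes "0 \<le> t0" "t0 \<le> t1" "t1 \<le> t2" "t2 \<le> t3" "t3 \<le> 1"
  shows "ennreal (dist (g t0) (g t1) + dist (g t1) (g t2) + dist (g t2) (g t3)) \<le> curve_length g"
proof -
  define t where "t i = (if i = 0 then t0 else if i = 1 then t1 else if i = 2 then t2 else t3)"
    for i :: nat
  have "mono_on {..3} t"
    unfolding mono_on_def t_def using assms by auto
  moreover have "t ` {..3} \<subseteq> {0..1}"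
    unfolding t_def using assms by auto
  ultimately have "(\<Sum>i<3. ennreal (dist (g (t i)) (g (t (Suc i))))) \<le> curve_length g"
    unfolding curve_length_def by (intro SUP_upper2[of "(3, t)"]) auto
  moreover have "(\<Sum>i<3. dist (g (t i)) (g (t (Suc i)))) =
       dist (g t0) (g t1) + dist (g t1) (g t2) + dist (g t2) (g t3)"
    by (simp add: t_def eval_nat_numeral)
  ultimately show ?thesis
    by (simp add: sum_ennreal)
qed

lemma path_through_four_points:
  assumes sub: "{A, B, C, D} \<subseteq> path_image g" and card: "card {A, B, C, D} = 4"
  obtains P1 P2 P3 P4 where "{P1, P2, P3, P4} = {A, B, C, D}"
    "ennreal (dist P1 P2 + dist P2 P3 + dist P3 P4) \<le> curve_length g"
proof -
  have "\<forall>P\<in>{A, B, C, D}. \<exists>t. 0 \<le> t \<and> t \<le> 1 \<and> g t = P"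
    using sub by (auto simp: path_image_def image_iff)
  then obtain f where f: "\<And>P. P \<in> {A, B, C, D} \<Longrightarrow> 0 \<le> f P \<and> f P \<le> 1 \<and> g (f P) = P"
    by (metis (no_types, lifting))
  define l where "l = sort_key f [A, B, C, D]"
  have l: "length l = 4" "set l = {A, B, C, D}" "sorted (map f l)"
    unfolding l_def by (simp_all only: length_sort set_sort sorted_sort_key) simp_all
  then obtain P1 P2 P3 P4 where P: "l = [P1, P2, P3, P4]"
    by (auto simp: eval_nat_numeral length_Suc_conv)
  then have set: "{P1, P2, P3, P4} = {A, B, C, D}" using l by simp
  have "ennreal (dist (g (f P1)) (g (f P2)) + dist (g (f P2)) (g (f P3)) + dist (g (f P3)) (g (f P4)))
      \<le> curve_length g"
    using l(3) f[of P1] f[of P4] unfolding P set[symmetric]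
    by (intro curve_length_ge_three_chords) auto
  moreover have "g (f P1) = P1" "g (f P2) = P2" "g (f P3) = P3" "g (f P4) = P4"
    using f set by auto
  ultimately show ?thesis using that[OF set] by simp
qed

lemma three_element_set_eq_cases:
  assumes "{x, y, z} = {a, b, c}" "a \<noteq> b" "a \<noteq> c" "b \<noteq> c"
  shows "x = a \<and> y = b \<and> z = c \<or> x = a \<and> y = c \<and> z = b \<or> x = b \<and> y = a \<and> z = c \<or>
    x = b \<and> y = c \<and> z = a \<or> x = c \<and> y = a \<and> z = b \<or> x = c \<and> y = b \<and> z = a"
  using assms by (smt (verit, best) doubleton_eq_iff insert_commute insert_iff singletonD)

text \<open>
  A chain through the vertices of the kite consists of both diagonals and one side, of two opposite
  sides and a diagonal, or of three sides. Chains of the first two kinds have length at least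
  \<open>p + q + l\<close>, since no side or diagonal exceeds \<open>2 * w\<close>.
\<close>

lemma kite_chain_length:
  fixes A B C D :: "'a::metric_space"
  assumes d: "dist A B = p" "dist B C = p" "dist A D = q" "dist C D = q" "dist A C = 2 * w" "dist B D = l"
    and short: "l \<le> 2 * w" "p \<le> 2 * w" "q \<le> 2 * w"
    and H: "H \<le> p + q + l" "H \<le> 2 * q + p" "H \<le> 2 * p + q"
    and P: "{P1, P2, P3, P4} = {A, B, C, D}" "card {A, B, C, D} = 4"
  shows "H \<le> dist P1 P2 + dist P2 P3 + dist P3 P4"
proof -
  have d': "dist B A = p" "dist C B = p" "dist D A = q" "dist D C = q" "dist C A = 2 * w" "dist D B = l"
    using d by (simp_all add: dist_commute)
  have ne: "A \<noteq> B" "A \<noteq> C" "A \<noteq> D" "B \<noteq> C" "B \<noteq> D" "C \<noteq> D"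
    using P(2) by (auto simp: card_insert_if split: if_splits)
  have "card {P1, P2, P3, P4} = 4" using P by simp
  then have "P1 \<notin> {P2, P3, P4}"
    by (auto simp: card_insert_if split: if_splits)
  then have rest: "{P2, P3, P4} = {A, B, C, D} - {P1}"
    using P(1) by blast
  have "P1 = A \<or> P1 = B \<or> P1 = C \<or> P1 = D" using P(1) by blast
  then consider "P1 = A" "{P2, P3, P4} = {B, C, D}" | "P1 = B" "{P2, P3, P4} = {A, C, D}"
    | "P1 = C" "{P2, P3, P4} = {A, B, D}" | "P1 = D" "{P2, P3, P4} = {A, B, C}"
    unfolding rest using ne by fastforce
  then show ?thesis
  proof cases
    case 1
    show ?thesis
      using three_element_set_eq_cases[OF 1(2) ne(4,5,6)] short H unfolding 1(1)
      by (elim disjE; simp add: d d')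
  next
    case 2
    show ?thesis
      using three_element_set_eq_cases[OF 2(2) ne(2,3,6)] short H unfolding 2(1)
      by (elim disjE; simp add: d d')
  next
    case 3
    show ?thesis
      using three_element_set_eq_cases[OF 3(2) ne(1,3,5)] short H unfolding 3(1)
      by (elim disjE; simp add: d d')
  next
    case 4
    show ?thesis
      using three_element_set_eq_cases[OF 4(2) ne(1,2,4)] short H unfolding 4(1)
      by (elim disjE; simp add: d d')
  qed
qed

theorem theorem1:
  fixes K :: "(real ^ 2) set"
  assumes "convex_shape K"
  shows "\<exists>P. P \<subseteq> frontier K \<and> card P = 4 \<and>
           (\<forall>g. rectifiable g \<and> P \<subseteq> path_image g \<longrightarrow>
              curve_length g \<ge> ennreal (1 / 2) * perimeter K)"
proof -
  obtain A B C D w b d where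
    fr: "{A, B, C, D} \<subseteq> frontier K" and w: "0 < w" and b: "0 \<le> b" and d: "0 \<le> d" and bd: "0 < b + d"
    and AC: "dist A C = 2 * w" and BD: "dist B D = b + d"
    and AB: "dist A B = sqrt (w\<^sup>2 + b\<^sup>2)" and BC: "dist B C = sqrt (w\<^sup>2 + b\<^sup>2)"
    and AD: "dist A D = sqrt (w\<^sup>2 + d\<^sup>2)" and CD: "dist C D = sqrt (w\<^sup>2 + d\<^sup>2)"
    and diam: "\<And>P Q. P \<in> K \<Longrightarrow> Q \<in> K \<Longrightarrow> dist P Q \<le> 2 * w"
    and per1: "perimeter K \<le> ennreal (2 * (sqrt (w\<^sup>2 + b\<^sup>2) + sqrt (w\<^sup>2 + d\<^sup>2) + (b + d)))"
    and per2: "perimeter K \<le> ennreal (8 * (sqrt 2 - 1) * (2 * w))"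
    using diameter_and_perpendicular_bisector[OF assms] by metis
  define p q where "p = sqrt (w\<^sup>2 + b\<^sup>2)" and "q = sqrt (w\<^sup>2 + d\<^sup>2)"
  have sides: "dist A B = p" "dist B C = p" "dist A D = q" "dist C D = q"
    by (simp_all add: p_def q_def AB BC AD CD)
  \<comment> \<open>the better of the two upper bounds for half the perimeter\<close>
  define H where "H = min (p + q + (b + d)) (8 * (sqrt 2 - 1) * w)"
  have pq: "0 < p" "0 < q"
    using w by (auto simp: p_def q_def intro: add_pos_nonneg)
  have K: "A \<in> K" "B \<in> K" "C \<in> K" "D \<in> K"
    using fr assms frontier_subset_closed[of K] by (auto simp: convex_shape_def compact_imp_closed)
  have short: "b + d \<le> 2 * w" "p \<le> 2 * w" "q \<le> 2 * w"
    using diam[OF K(2,4)] diam[OF K(1,2)] diam[OF K(1,4)] by (simp_all add: BD AB AD p_def q_def)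
  have H1: "H \<le> p + q + (b + d)" by (simp add: H_def)
  \<comment> \<open>a chain of three sides is controlled by the first or the second bound, depending on
      whether \<open>b + d\<close> exceeds the side that occurs twice\<close>
  have H2: "H \<le> 2 * q + p"
    using two_short_sides_and_long_side[OF w b d]
    by (cases "b + d \<le> q") (simp_all add: H_def p_def q_def)
  have H3: "H \<le> 2 * p + q"
    using two_short_sides_and_long_side[OF w d b]
    by (cases "b + d \<le> p") (simp_all add: H_def p_def q_def add.commute)
  have "2 * H = 2 * (p + q + (b + d)) \<or> 2 * H = 8 * (sqrt 2 - 1) * (2 * w)"
    by (simp add: H_def min_def)
  then have "perimeter K \<le> ennreal (2 * H)"
    using per1 per2 unfolding p_def q_def by metis
  then have "ennreal (1/2) * perimeter K \<le> ennreal (1/2) * ennreal (2 * H)"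
    by (intro mult_left_mono) auto
  also have "\<dots> = ennreal H"
    by (subst ennreal_mult'[symmetric]) auto
  finally have per: "ennreal (1/2) * perimeter K \<le> ennreal H" .
  have ne: "A \<noteq> B" "A \<noteq> C" "A \<noteq> D" "B \<noteq> C" "B \<noteq> D" "C \<noteq> D"
    using AB AC AD BC BD CD pq w bd by (auto simp: p_def q_def)
  then have card: "card {A, B, C, D} = 4" by auto
  have chain: "H \<le> dist P1 P2 + dist P2 P3 + dist P3 P4" if "{P1, P2, P3, P4} = {A, B, C, D}" for P1 P2 P3 P4
    by (rule kite_chain_length[OF sides AC BD short H1 H2 H3 that card])
  have "ennreal (1/2) * perimeter K \<le> curve_length g" if sub: "{A, B, C, D} \<subseteq> path_image g" for g
  proof -
    obtain P1 P2 P3 P4 where "{P1, P2, P3, P4} = {A, B, C, D}"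
      and len: "ennreal (dist P1 P2 + dist P2 P3 + dist P3 P4) \<le> curve_length g"
      using path_through_four_points[OF sub card] by blast
    then have "H \<le> dist P1 P2 + dist P2 P3 + dist P3 P4"
      by (intro chain)
    then have "ennreal H \<le> ennreal (dist P1 P2 + dist P2 P3 + dist P3 P4)"
      by (rule ennreal_leI)
    with per len show ?thesis by (meson order_trans)
  qed
  then show ?thesis
    using fr card by (intro exI[of _ "{A, B, C, D}"]) auto
qed

end
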